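(* Let $g$ be a left-invariant pseudo-Riemannian metric on a Lie group $G$ of type $\mathcal F$ with Lie algebra $\mathfrak g$. Then the Euler-Arnold vector field of (the Levi-Civita connection of) $g$ is $i\mathbb R$-complete if and only if either $g$ is degenerate on the derived Lie subalgebra $\mathfrak g'=[\mathfrak g,\mathfrak g]$, or $g$ is definite on $\mathfrak g'$ but indefinite on $\mathfrak g$.
   Context: A non-commutative real Lie algebra $\mathfrak g$ is of type $\mathcal F$ if for any $x,y\in\mathfrak g$ the bracket $[x,y]$ is a linear combination of $x$ and $y$ (equivalently there is $0\ne l\in\mathfrak g^*$ with $[x,y]=l(y)x-l(x)y$). A non-commutative Lie group is of type $\mathcal F$ if its Lie algebra is of type $\mathcal F$. The Euler-Arnold vector field of a left invariant connection $\nabla$ is the vector field $\mathcal W(x)=-(\nabla_xx)_e$ on $\mathfrak g=T_eG$ ($x$ extended to a left invariant field); for the Levi-Civita connection of a left invariant metric $g$ it equals $\mathcal W(x)=\operatorname{ad}_x^*x$, the adjoint $*$ being taken with respect to $g_e$. A smooth real vector field on an $n$-dimensional real vector space (identified with $\mathbb R^n$) is $i\mathbb R$-complete if every trajectory extends to a holomorphic map $U\to\mathbb{C}^n$, where $U$ is some open neighborhood of $i\mathbb R$ in $\mathbb C$ that may depend on the trajectory (trajectories being integral curves with initial condition at time $0$). *)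

theory Defs
  imports "HOL-Complex_Analysis.Complex_Analysis" "HOL-Library.Function_Algebras"
begin

text \<open>Functions into a real vector space form a real vector space under the pointwise operations.
  Tangent vectors (functionals on smooth functions) and vector fields inherit their linear
  structure, and hence \<open>span\<close> and \<open>linear\<close>, from this instance.\<close>

instantiation "fun" :: (type, real_vector) real_vector
begin

definition scaleR_fun :: "real \<Rightarrow> ('a \<Rightarrow> 'b) \<Rightarrow> 'a \<Rightarrow> 'b" where
  "scaleR_fun c f = (\<lambda>x. c *\<^sub>R f x)"

instance
  by standard (simp_all add: scaleR_fun_def fun_eq_iff scaleR_add_right scaleR_add_left)

end

section \<open>Smooth manifolds and Lie groups\<close>

text \<open>\<open>Ck_on k S f\<close>: \<open>f\<close> is of class \<open>C\<^sup>k\<close> on the open set \<open>S\<close>; only used for open subsets of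
  finite-dimensional spaces, where having all directional derivatives of the derivative of class
  \<open>C\<^sup>k\<close> is the same as having a derivative of class \<open>C\<^sup>k\<close>.\<close>

primrec Ck_on :: "nat \<Rightarrow> 'a::real_normed_vector set \<Rightarrow> ('a \<Rightarrow> 'b::real_normed_vector) \<Rightarrow> bool" where
  "Ck_on 0 = (\<lambda>S f. continuous_on S f)"
| "Ck_on (Suc k) = (\<lambda>S f. (\<forall>x\<in>S. f differentiable (at x)) \<and>
      (\<forall>v. Ck_on k S (\<lambda>x. frechet_derivative f (at x) v)))"

definition smooth_on :: "'a::real_normed_vector set \<Rightarrow> ('a \<Rightarrow> 'b::real_normed_vector) \<Rightarrow> bool" where
  "smooth_on S f \<longleftrightarrow> (\<forall>k. Ck_on k S f)"

text \<open>A chart is a pair of its domain and its coordinate map, which is relevant on the domain only.\<close>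

type_synonym ('p, 'n) chart = "'p set \<times> ('p \<Rightarrow> real ^ 'n)"
type_synonym ('p, 'n) atlas = "('p, 'n) chart set"

definition smooth_atlas :: "('p::topological_space, 'n::finite) atlas \<Rightarrow> bool" where
  "smooth_atlas A \<longleftrightarrow>
     (\<Union>(U, \<phi>)\<in>A. U) = UNIV \<and>
     (\<forall>(U, \<phi>)\<in>A. open U \<and> open (\<phi> ` U) \<and> homeomorphism U (\<phi> ` U) \<phi> (inv_into U \<phi>)) \<and>
     (\<forall>(U, \<phi>)\<in>A. \<forall>(V, \<psi>)\<in>A. smooth_on (\<phi> ` (U \<inter> V)) (\<psi> \<circ> inv_into U \<phi>))"

text \<open>The group is written additively because the library's class of (not necessarily commutative)
  topological groups is: \<open>p + q\<close> is the group product, \<open>- p\<close> the inverse and \<open>0\<close> the unit \<open>e\<close>.\<close>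

definition lie_group ::
    "('p::{topological_group_add, t2_space, second_countable_topology}, 'n::finite) atlas \<Rightarrow> bool" where
  "lie_group A \<longleftrightarrow>
     smooth_atlas A \<and>
     (\<forall>(U, \<phi>)\<in>A. \<forall>(V, \<psi>)\<in>A. \<forall>(W, \<theta>)\<in>A.
        smooth_on {(\<phi> p, \<psi> q) | p q. p \<in> U \<and> q \<in> V \<and> p + q \<in> W}
          (\<lambda>(x, y). \<theta> (inv_into U \<phi> x + inv_into V \<psi> y))) \<and>
     (\<forall>(U, \<phi>)\<in>A. \<forall>(V, \<psi>)\<in>A.
        smooth_on (\<phi> ` {p \<in> U. - p \<in> V}) (\<lambda>x. \<psi> (- inv_into U \<phi> x)))"

definition smooth_fun :: "('p, 'n::finite) atlas \<Rightarrow> ('p \<Rightarrow> real) \<Rightarrow> bool" where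
  "smooth_fun A f \<longleftrightarrow> (\<forall>(U, \<phi>)\<in>A. smooth_on (\<phi> ` U) (f \<circ> inv_into U \<phi>))"

section \<open>Tangent vectors and vector fields\<close>

text \<open>Tangent vectors at \<open>p\<close> are the directional derivatives at \<open>p\<close> of smooth functions. As
  functions in HOL are total, they are given the value 0 at all functions that are not smooth, so
  that equality of tangent vectors is equality of functionals.\<close>

type_synonym 'p tangent = "('p \<Rightarrow> real) \<Rightarrow> real"
type_synonym 'p vfield = "'p \<Rightarrow> 'p tangent"

definition chart_tangent :: "('p, 'n::finite) atlas \<Rightarrow> ('p, 'n) chart \<Rightarrow> 'p \<Rightarrow> real ^ 'n \<Rightarrow> 'p tangent" where
  "chart_tangent A c p v = (case c of (U, \<phi>) \<Rightarrow>
     (\<lambda>f. if smooth_fun A f then frechet_derivative (f \<circ> inv_into U \<phi>) (at (\<phi> p)) v else 0))"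

definition tangent_space :: "('p, 'n::finite) atlas \<Rightarrow> 'p \<Rightarrow> 'p tangent set" where
  "tangent_space A p = {chart_tangent A c p v | c v. c \<in> A \<and> p \<in> fst c}"

definition vector_field :: "('p, 'n::finite) atlas \<Rightarrow> 'p vfield \<Rightarrow> bool" where
  "vector_field A X \<longleftrightarrow>
     (\<forall>p. X p \<in> tangent_space A p) \<and> (\<forall>f. smooth_fun A f \<longrightarrow> smooth_fun A (\<lambda>p. X p f))"

definition lie_bracket :: "'p vfield \<Rightarrow> 'p vfield \<Rightarrow> 'p vfield" where
  "lie_bracket X Y = (\<lambda>p f. X p (\<lambda>q. Y q f) - Y p (\<lambda>q. X q f))"

section \<open>The Lie algebra of a Lie group\<close>

text \<open>The differential of the left translation by \<open>p\<close>, as a push-forward of functionals.\<close>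

definition left_translate :: "('p::plus, 'n::finite) atlas \<Rightarrow> 'p \<Rightarrow> 'p tangent \<Rightarrow> 'p tangent" where
  "left_translate A p u = (\<lambda>f. if smooth_fun A f then u (\<lambda>q. f (p + q)) else 0)"

definition lie_algebra :: "('p::plus, 'n::finite) atlas \<Rightarrow> 'p vfield set" where
  "lie_algebra A = {X. vector_field A X \<and> (\<forall>p q. X (p + q) = left_translate A p (X q))}"

definition derived_algebra :: "('p::plus, 'n::finite) atlas \<Rightarrow> 'p vfield set" where
  "derived_algebra A = span {lie_bracket X Y | X Y. X \<in> lie_algebra A \<and> Y \<in> lie_algebra A}"

definition type_F_algebra :: "'v::real_vector set \<Rightarrow> ('v \<Rightarrow> 'v \<Rightarrow> 'v) \<Rightarrow> bool" where
  "type_F_algebra L br \<longleftrightarrow>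
     (\<exists>x\<in>L. \<exists>y\<in>L. br x y \<noteq> 0) \<and>
     (\<forall>x\<in>L. \<forall>y\<in>L. \<exists>a b. br x y = a *\<^sub>R x + b *\<^sub>R y)"

definition type_F_group :: "('p::plus, 'n::finite) atlas \<Rightarrow> bool" where
  "type_F_group A \<longleftrightarrow>
     (\<exists>p q :: 'p. p + q \<noteq> q + p) \<and> type_F_algebra (lie_algebra A) lie_bracket"

section \<open>Pseudo-Riemannian metrics and the Levi-Civita connection\<close>

definition pseudo_riemannian ::
    "('p, 'n::finite) atlas \<Rightarrow> ('p \<Rightarrow> 'p tangent \<Rightarrow> 'p tangent \<Rightarrow> real) \<Rightarrow> bool" where
  "pseudo_riemannian A g \<longleftrightarrow>
     (\<forall>p. \<forall>u\<in>tangent_space A p. \<forall>v\<in>tangent_space A p. g p u v = g p v u) \<and>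
     (\<forall>p. \<forall>u\<in>tangent_space A p. \<forall>v\<in>tangent_space A p. \<forall>w\<in>tangent_space A p. \<forall>a b.
        g p (a *\<^sub>R u + b *\<^sub>R v) w = a * g p u w + b * g p v w) \<and>
     (\<forall>p. \<forall>u\<in>tangent_space A p. (\<forall>v\<in>tangent_space A p. g p u v = 0) \<longrightarrow> u = 0) \<and>
     (\<forall>X Y. vector_field A X \<longrightarrow> vector_field A Y \<longrightarrow> smooth_fun A (\<lambda>p. g p (X p) (Y p)))"

definition left_invariant_metric ::
    "('p::plus, 'n::finite) atlas \<Rightarrow> ('p \<Rightarrow> 'p tangent \<Rightarrow> 'p tangent \<Rightarrow> real) \<Rightarrow> bool" where
  "left_invariant_metric A g \<longleftrightarrow>
     (\<forall>p q. \<forall>u\<in>tangent_space A q. \<forall>v\<in>tangent_space A q.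
        g (p + q) (left_translate A p u) (left_translate A p v) = g q u v)"

definition affine_connection ::
    "('p, 'n::finite) atlas \<Rightarrow> ('p vfield \<Rightarrow> 'p vfield \<Rightarrow> 'p vfield) \<Rightarrow> bool" where
  "affine_connection A nabla \<longleftrightarrow>
     (\<forall>X Y. vector_field A X \<longrightarrow> vector_field A Y \<longrightarrow> vector_field A (nabla X Y)) \<and>
     (\<forall>X Y Z. vector_field A X \<longrightarrow> vector_field A Y \<longrightarrow> vector_field A Z \<longrightarrow>
        nabla (X + Y) Z = nabla X Z + nabla Y Z \<and>
        nabla X (Y + Z) = nabla X Y + nabla X Z) \<and>
     (\<forall>f X Y. smooth_fun A f \<longrightarrow> vector_field A X \<longrightarrow> vector_field A Y \<longrightarrow>
        nabla (\<lambda>p. f p *\<^sub>R X p) Y = (\<lambda>p. f p *\<^sub>R nabla X Y p) \<and>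
        nabla X (\<lambda>p. f p *\<^sub>R Y p) = (\<lambda>p. X p f *\<^sub>R Y p + f p *\<^sub>R nabla X Y p))"

definition levi_civita_connection ::
    "('p, 'n::finite) atlas \<Rightarrow> ('p \<Rightarrow> 'p tangent \<Rightarrow> 'p tangent \<Rightarrow> real) \<Rightarrow>
     ('p vfield \<Rightarrow> 'p vfield \<Rightarrow> 'p vfield) \<Rightarrow> bool" where
  "levi_civita_connection A g nabla \<longleftrightarrow>
     affine_connection A nabla \<and>
     (\<forall>X Y. vector_field A X \<longrightarrow> vector_field A Y \<longrightarrow>
        nabla X Y - nabla Y X = lie_bracket X Y) \<and>
     (\<forall>X Y Z. vector_field A X \<longrightarrow> vector_field A Y \<longrightarrow> vector_field A Z \<longrightarrow>
        (\<forall>p. X p (\<lambda>q. g q (Y q) (Z q)) = g p (nabla X Y p) (Z p) + g p (Y p) (nabla X Z p)))"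

text \<open>\<open>W(x) = -(\<nabla>\<^sub>x x)\<^sub>e\<close>. An element of the Lie algebra is represented by a left-invariant vector
  field, so \<open>x\<close> is its own left-invariant extension, and the resulting tangent vector at \<open>e\<close> is
  turned back into a left-invariant field by left translation.\<close>

definition euler_arnold ::
    "('p::{plus, zero}, 'n::finite) atlas \<Rightarrow> ('p vfield \<Rightarrow> 'p vfield \<Rightarrow> 'p vfield) \<Rightarrow> 'p vfield \<Rightarrow> 'p vfield" where
  "euler_arnold A nabla x = (\<lambda>p. left_translate A p (- nabla x x 0))"

text \<open>The scalar product that a left-invariant metric induces on the Lie algebra.\<close>

definition metric_at_unit ::
    "('p::zero \<Rightarrow> 'p tangent \<Rightarrow> 'p tangent \<Rightarrow> real) \<Rightarrow> 'p vfield \<Rightarrow> 'p vfield \<Rightarrow> real" where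
  "metric_at_unit g x y = g 0 (x 0) (y 0)"

definition degenerate_on :: "'v::real_vector set \<Rightarrow> ('v \<Rightarrow> 'v \<Rightarrow> real) \<Rightarrow> bool" where
  "degenerate_on S b \<longleftrightarrow> (\<exists>x\<in>S. x \<noteq> 0 \<and> (\<forall>y\<in>S. b x y = 0))"

definition definite_on :: "'v::real_vector set \<Rightarrow> ('v \<Rightarrow> 'v \<Rightarrow> real) \<Rightarrow> bool" where
  "definite_on S b \<longleftrightarrow> (\<forall>x\<in>S. x \<noteq> 0 \<longrightarrow> b x x > 0) \<or> (\<forall>x\<in>S. x \<noteq> 0 \<longrightarrow> b x x < 0)"

definition indefinite_on :: "'v::real_vector set \<Rightarrow> ('v \<Rightarrow> 'v \<Rightarrow> real) \<Rightarrow> bool" where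
  "indefinite_on S b \<longleftrightarrow> (\<exists>x\<in>S. b x x > 0) \<and> (\<exists>x\<in>S. b x x < 0)"

section \<open>Completeness along the imaginary axis\<close>

definition trajectory :: "(real ^ 'n::finite \<Rightarrow> real ^ 'n) \<Rightarrow> real set \<Rightarrow> (real \<Rightarrow> real ^ 'n) \<Rightarrow> bool" where
  "trajectory W I \<gamma> \<longleftrightarrow>
     open I \<and> is_interval I \<and> 0 \<in> I \<and> (\<forall>t\<in>I. (\<gamma> has_vector_derivative W (\<gamma> t)) (at t))"

text \<open>\<open>U\<close> may depend on the trajectory and may be shrunk; the extension is required to agree with the
  trajectory wherever both are defined. A map into \<open>\<complex>\<^sup>n\<close> is holomorphic iff its components are.\<close>

definition iR_complete :: "(real ^ 'n::finite \<Rightarrow> real ^ 'n) \<Rightarrow> bool" where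
  "iR_complete W \<longleftrightarrow>
     (\<forall>I \<gamma>. trajectory W I \<gamma> \<longrightarrow>
        (\<exists>U (F :: complex \<Rightarrow> complex ^ 'n).
           open U \<and> {z. Re z = 0} \<subseteq> U \<and>
           (\<forall>i. (\<lambda>z. F z $ i) holomorphic_on U) \<and>
           (\<forall>t\<in>I. complex_of_real t \<in> U \<longrightarrow>
              (\<forall>i. F (complex_of_real t) $ i = complex_of_real (\<gamma> t $ i)))))"

end

theory Submission
  imports Defs
begin

text \<open>Transport everything to \<open>V = \<real>\<^sup>n\<close> along \<open>\<iota>\<close>. A type F bracket has the form \<open>[x, y] = l(y) x - l(x) y\<close> with a
linear functional \<open>l \<noteq> 0\<close> (lemma \<open>type_F_bracket_functional\<close>), and its derived algebra is the kernel
of \<open>l\<close> (\<open>span_type_F_brackets\<close>). Let \<open>b\<close> be the scalar product on \<open>V\<close> and let \<open>a\<close> represent \<open>l\<close>, that is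
\<open>l = b(a, \<cdot>)\<close>; then the derived algebra is \<open>a\<^sup>\<bottom>\<close>. Torsion-freeness and metric compatibility of the
connection give \<open>b(W x, z) = b(x, [x, z])\<close> (\<open>metric_euler_field\<close>), so the Euler-Arnold field is
\<open>W x = b(x, x) a - b(a, x) x\<close>.

Along a trajectory \<open>x\<close> the energy \<open>q = b(x, x)\<close> is constant, and \<open>u = b(a, x)\<close> solves the Riccati equation
\<open>u' = k - u\<^sup>2\<close> with the constant \<open>k = b(a, a) q\<close>. Hence \<open>u = s'/s\<close>, where \<open>s'' = k s\<close>, \<open>s(0) = 1\<close> and
\<open>s'(0) = u(0)\<close>. The factor \<open>s\<close> linearizes the flow: \<open>(s x)' = q s a\<close>, so \<open>s x = x(0) + q S a\<close> with
\<open>S' = s\<close>, \<open>S(0) = 0\<close> (\<open>trajectory_linearized\<close>). Both \<open>s\<close> and \<open>S\<close> are entire, so \<open>x\<close> extends meromorphically to \<open>\<complex>\<close>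
and only the zeros of \<open>s\<close> can obstruct. These lie on the imaginary axis only if \<open>k > 0\<close> and
\<open>u(0) = 0\<close>, where \<open>s(i\<tau>) = cos(\<surd>k \<tau>)\<close>. In that case the numerator at the first zero has real part
\<open>x(0) \<noteq> 0\<close>, and there is a pole. The field is therefore complete along the imaginary axis iff
\<open>b(a, a) b(x, x) \<le> 0\<close> for all \<open>x \<in> a\<^sup>\<bottom>\<close>.

If \<open>b(a, a) = 0\<close>, this is automatic, and it is exactly the case of a degenerate derived algebra, as
\<open>a\<close> then lies in \<open>a\<^sup>\<bottom>\<close> and spans its radical. Otherwise \<open>V = \<real>a \<oplus> a\<^sup>\<bottom>\<close> orthogonally with \<open>b\<close> nondegenerate on
\<open>a\<^sup>\<bottom>\<close>; the condition says that \<open>b\<close> is definite there with the sign opposite to \<open>b(a, a)\<close>, which means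
definite on \<open>a\<^sup>\<bottom>\<close> and indefinite on \<open>V\<close> (\<open>perp_sign_condition_iff\<close>).\<close>

unbundle no fps_syntax

section \<open>Scalar linear differential equations\<close>

lemma cosh_sinh_of_real:
  "cosh (complex_of_real x) = of_real (cosh x)" "sinh (complex_of_real x) = of_real (sinh x)"
  by (simp_all add: cosh_field_def sinh_field_def exp_of_real flip: of_real_minus)

text \<open>The derivative of \<open>exp (\<integral> u) w\<close> vanishes. The integral runs from the left end of the
segment between 0 and \<open>t\<close>, as \<open>t\<close> may be negative.\<close>
lemma linear_ode_unique_zero:
  fixes u :: "real \<Rightarrow> real" and w :: "real \<Rightarrow> 'a::real_normed_vector"
  assumes I: "is_interval I" "0 \<in> I" and u: "continuous_on I u"
    and w: "\<And>t. t \<in> I \<Longrightarrow> (w has_vector_derivative - u t *\<^sub>R w t) (at t)"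
    and w0: "w 0 = 0" and t: "t \<in> I"
  shows "w t = 0"
proof -
  define J where "J = {min 0 t..max 0 t}"
  have JI: "J \<subseteq> I"
  proof
    fix x assume "x \<in> J"
    then show "x \<in> I"
      using I t mem_is_interval_1_I[of I 0 t x] mem_is_interval_1_I[of I t 0 x]
      by (auto simp: J_def min_def max_def split: if_splits)
  qed
  define P where "P = (\<lambda>x. integral {min 0 t..x} u)"
  have P: "(P has_real_derivative u x) (at x within J)" if "x \<in> J" for x
    using integral_has_real_derivative[of "min 0 t" "max 0 t" u x] continuous_on_subset[OF u JI] that
    unfolding P_def J_def by simp
  have "((\<lambda>x. exp (P x) *\<^sub>R w x) has_vector_derivative 0) (at x within J)" if x: "x \<in> J" for x
  proof -
    have "((\<lambda>x. exp (P x)) has_real_derivative exp (P x) * u x) (at x within J)"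
      using P[OF x] by (auto intro!: derivative_eq_intros)
    moreover have "(w has_vector_derivative - u x *\<^sub>R w x) (at x within J)"
      using w x JI by (blast intro: has_vector_derivative_at_within)
    ultimately show ?thesis
      by (rule has_vector_derivative_eq_rhs[OF has_vector_derivative_scaleR]) simp
  qed
  moreover have "convex J" "0 \<in> J" "t \<in> J"
    by (auto simp: J_def)
  ultimately have "exp (P t) *\<^sub>R w t = exp (P 0) *\<^sub>R w 0"
    using has_vector_derivative_zero_constant[of J "\<lambda>x. exp (P x) *\<^sub>R w x"] by metis
  then show ?thesis
    by (simp add: w0)
qed

text \<open>The three cases are \<open>s = 1 + u\<^sub>0 z\<close>, \<open>s = cosh(rz) + (u\<^sub>0/r) sinh(rz)\<close> with \<open>r = \<surd>k\<close>, and
\<open>s = cos(rz) + (u\<^sub>0/r) sin(rz)\<close> with \<open>r = \<surd>(-k)\<close>. On the imaginary axis the real part of \<open>s\<close> is \<open>1\<close>,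
\<open>cos(r\<tau>)\<close> and \<open>cosh(r\<tau>)\<close> respectively. Only the second can vanish, and then the imaginary part
\<open>(u\<^sub>0/r) sin(r\<tau>)\<close> does not unless \<open>u\<^sub>0 = 0\<close>.\<close>
lemma fundamental_solution_exists:
  fixes k u0 :: real
  obtains s s1 S :: "complex \<Rightarrow> complex"
  where "\<And>z. (s has_field_derivative s1 z) (at z)"
    and "\<And>z. (s1 has_field_derivative of_real k * s z) (at z)"
    and "\<And>z. (S has_field_derivative s z) (at z)"
    and "s 0 = 1" and "s1 0 = of_real u0" and "S 0 = 0"
    and "\<And>z. \<not> (k > 0 \<and> u0 = 0) \<Longrightarrow> Re z = 0 \<Longrightarrow> s z \<noteq> 0"
proof -
  consider "k = 0" | "k > 0" | "k < 0" by linarith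
  then show ?thesis
  proof cases
    case 1
    show ?thesis
    proof (rule that[of "\<lambda>z. 1 + of_real u0 * z" "\<lambda>_. of_real u0" "\<lambda>z. z + of_real u0 * z\<^sup>2 / 2"])
      fix z :: complex assume "Re z = 0"
      then have "Re (1 + of_real u0 * z) = 1" by simp
      then show "1 + of_real u0 * z \<noteq> 0" by force
    qed (auto simp: 1 intro!: derivative_eq_intros)
  next
    case 2
    define r where "r = sqrt k"
    have r: "r > 0" and k: "k = r * r" using 2 by (auto simp: r_def)
    show ?thesis
    proof (rule that[of "\<lambda>z. cosh (of_real r * z) + of_real u0 / of_real r * sinh (of_real r * z)"
          "\<lambda>z. of_real r * sinh (of_real r * z) + of_real u0 * cosh (of_real r * z)"
          "\<lambda>z. sinh (of_real r * z) / of_real r + of_real (u0 / k) * (cosh (of_real r * z) - 1)"])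
      fix z :: complex assume u0: "\<not> (k > 0 \<and> u0 = 0)" and "Re z = 0"
      then obtain \<tau> where z: "z = \<i> * of_real \<tau>"
        by (metis add_0 complex_eq of_real_0)
      have iz: "\<i> * (of_real r * z) = of_real (- (r * \<tau>))"
        by (simp add: z complex_eq_iff)
      have c: "cosh (of_real r * z) = of_real (cos (r * \<tau>))"
        by (simp only: cosh_conv_cos iz cos_of_real cos_minus)
      have s: "sinh (of_real r * z) = \<i> * of_real (sin (r * \<tau>))"
        by (simp only: sinh_conv_sin iz sin_of_real sin_minus) simp
      show "cosh (of_real r * z) + of_real u0 / of_real r * sinh (of_real r * z) \<noteq> 0"
      proof
        assume 0: "cosh (of_real r * z) + of_real u0 / of_real r * sinh (of_real r * z) = 0"
        from arg_cong[OF 0, of Re] have "cos (r * \<tau>) = 0" by (simp add: c s)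
        moreover from arg_cong[OF 0, of Im] have "sin (r * \<tau>) = 0" using u0 2 r by (simp add: c s)
        ultimately show False using sin_cos_squared_add[of "r * \<tau>"] by simp
      qed
    qed (use r in \<open>auto simp: k field_simps intro!: derivative_eq_intros\<close>)
  next
    case 3
    define r where "r = sqrt (- k)"
    have r: "r > 0" and k: "k = - (r * r)" using 3 by (auto simp: r_def)
    show ?thesis
    proof (rule that[of "\<lambda>z. cos (of_real r * z) + of_real u0 / of_real r * sin (of_real r * z)"
          "\<lambda>z. - of_real r * sin (of_real r * z) + of_real u0 * cos (of_real r * z)"
          "\<lambda>z. sin (of_real r * z) / of_real r + of_real (u0 / k) * (cos (of_real r * z) - 1)"])
      fix z :: complex assume "Re z = 0"
      then obtain \<tau> where z: "z = \<i> * of_real \<tau>"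
        by (metis add_0 complex_eq of_real_0)
      have iz: "of_real r * z = \<i> * complex_of_real (r * \<tau>)"
        by (simp add: z)
      have c: "cos (of_real r * z) = of_real (cosh (r * \<tau>))"
        by (simp only: iz cosh_conv_cos[symmetric] cosh_sinh_of_real)
      have s: "sin (of_real r * z) = \<i> * of_real (sinh (r * \<tau>))"
        by (simp only: iz cosh_sinh_of_real[symmetric] sinh_conv_sin) simp
      have "Re (cos (of_real r * z) + of_real u0 / of_real r * sin (of_real r * z)) = cosh (r * \<tau>)"
        by (simp add: c s)
      then show "cos (of_real r * z) + of_real u0 / of_real r * sin (of_real r * z) \<noteq> 0"
        using cosh_real_pos[of "r * \<tau>"] by (metis less_irrefl zero_complex.sel(1))
    qed (use r in \<open>auto simp: k field_simps intro!: derivative_eq_intros\<close>)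
  qed
qed

section \<open>Trajectories of the Euler-Arnold field in imaginary time\<close>

locale symmetric_form =
  fixes b :: "real ^ 'n::finite \<Rightarrow> real ^ 'n \<Rightarrow> real"
  assumes bil: "bounded_bilinear b" and sym: "b x y = b y x"
begin

sublocale bounded_bilinear b by (rule bil)

text \<open>The Euler-Arnold field of the bracket \<open>[x, y] = b(a, y) x - b(a, x) y\<close> and the scalar product \<open>b\<close>.\<close>
definition type_F_field :: "real ^ 'n \<Rightarrow> real ^ 'n \<Rightarrow> real ^ 'n" where
  "type_F_field a x = b x x *\<^sub>R a - b a x *\<^sub>R x"

lemma energy_conserved:
  assumes tr: "trajectory (type_F_field a) I \<gamma>" and t: "t \<in> I"
  shows "b (\<gamma> t) (\<gamma> t) = b (\<gamma> 0) (\<gamma> 0)"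
proof -
  have I: "is_interval I" "0 \<in> I"
    and \<gamma>: "\<And>t. t \<in> I \<Longrightarrow> (\<gamma> has_vector_derivative type_F_field a (\<gamma> t)) (at t)"
    using tr by (auto simp: trajectory_def)
  have "((\<lambda>t. b (\<gamma> t) (\<gamma> t)) has_vector_derivative 0) (at x within I)" if x: "x \<in> I" for x
  proof -
    have "((\<lambda>t. b (\<gamma> t) (\<gamma> t)) has_vector_derivative 0) (at x)"
      by (rule has_vector_derivative_eq_rhs[OF has_vector_derivative[OF \<gamma>[OF x] \<gamma>[OF x]]])
        (simp add: type_F_field_def diff_left diff_right scaleR_left scaleR_right sym)
    then show ?thesis by (rule has_vector_derivative_at_within)
  qed
  then show ?thesis
    using has_vector_derivative_zero_constant[of I "\<lambda>t. b (\<gamma> t) (\<gamma> t)"] I t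
      is_interval_convex by metis
qed

text \<open>The function \<open>w = u s - s'\<close> solves \<open>w' = -u w\<close> with \<open>w(0) = 0\<close>, so \<open>s' = u s\<close> along the trajectory.
Then \<open>(s x)' = u s x + s (q a - u x) = q s a\<close>.\<close>
lemma trajectory_linearized:
  assumes tr: "trajectory (type_F_field a) I \<gamma>"
    and s: "\<And>z. (s has_field_derivative s1 z) (at z)"
    and s1: "\<And>z. (s1 has_field_derivative of_real (b a a * b (\<gamma> 0) (\<gamma> 0)) * s z) (at z)"
    and S: "\<And>z. (S has_field_derivative s z) (at z)"
    and init: "s 0 = 1" "s1 0 = of_real (b a (\<gamma> 0))" "S 0 = 0"
    and t: "t \<in> I"
  shows "s (of_real t) * of_real (\<gamma> t $ i)
    = of_real (\<gamma> 0 $ i) + of_real (b (\<gamma> 0) (\<gamma> 0) * a $ i) * S (complex_of_real t)"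
proof -
  have I: "is_interval I" "0 \<in> I"
    and \<gamma>: "\<And>t. t \<in> I \<Longrightarrow> (\<gamma> has_vector_derivative type_F_field a (\<gamma> t)) (at t)"
    using tr by (auto simp: trajectory_def)
  define q where "q = b (\<gamma> 0) (\<gamma> 0)"
  define u where "u = (\<lambda>t. b a (\<gamma> t))"
  note of_real_deriv = has_vector_derivative_real_field
  have \<gamma>': "(\<gamma> has_vector_derivative (q *\<^sub>R a - u t *\<^sub>R \<gamma> t)) (at t)" if "t \<in> I" for t
    using \<gamma>[OF that] energy_conserved[OF tr that] by (simp add: type_F_field_def q_def u_def)
  have u': "(u has_vector_derivative (q * b a a - (u t)\<^sup>2)) (at t)" if "t \<in> I" for t
    unfolding u_def
    by (rule has_vector_derivative_eq_rhs
        [OF bounded_linear.has_vector_derivative[OF bounded_linear_right \<gamma>'[OF that]]])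
      (simp add: diff_right scaleR_right u_def power2_eq_square)
  have uc': "((\<lambda>t. complex_of_real (u t)) has_vector_derivative of_real (q * b a a - (u t)\<^sup>2)) (at t)"
    if "t \<in> I" for t
    using has_vector_derivative_of_real[OF u'[OF that, folded has_real_derivative_iff_has_vector_derivative]] .
  define w where "w = (\<lambda>t. of_real (u t) * s (of_real t) - s1 (of_real t))"
  have w: "w t = 0" if "t \<in> I" for t
  proof (rule linear_ode_unique_zero[OF I _ _ _ that])
    show "continuous_on I u"
      by (meson u' continuous_at_imp_continuous_on has_vector_derivative_continuous)
    show "w 0 = 0" by (simp add: w_def init u_def)
    fix t assume t: "t \<in> I"
    show "(w has_vector_derivative - u t *\<^sub>R w t) (at t)"
      unfolding w_def
      by (rule has_vector_derivative_eq_rhs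
          [OF has_vector_derivative_diff[OF has_vector_derivative_mult[OF uc'[OF t] of_real_deriv[OF s]]
              of_real_deriv[OF s1]]])
        (simp add: scaleR_conv_of_real algebra_simps q_def power2_eq_square)
  qed
  define D where "D = (\<lambda>t. s (of_real t) * of_real (\<gamma> t $ i) - of_real (q * a $ i) * S (of_real t))"
  have "(D has_vector_derivative 0) (at t within I)" if t: "t \<in> I" for t
  proof -
    have "((\<lambda>t. \<gamma> t $ i) has_real_derivative (q * a $ i - u t * \<gamma> t $ i)) (at t)"
      unfolding has_real_derivative_iff_has_vector_derivative
      using bounded_linear.has_vector_derivative[OF bounded_linear_vec_nth \<gamma>'[OF t], of i] by simp
    from has_vector_derivative_of_real[OF this]
    have \<gamma>i: "((\<lambda>t. complex_of_real (\<gamma> t $ i)) has_vector_derivative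
      of_real (q * a $ i - u t * \<gamma> t $ i)) (at t)" .
    have s1u: "s1 (of_real t) = of_real (u t) * s (of_real t)"
      using w[OF t] by (simp add: w_def)
    have "(D has_vector_derivative 0) (at t)"
      unfolding D_def
      by (rule has_vector_derivative_eq_rhs
          [OF has_vector_derivative_diff[OF has_vector_derivative_mult[OF of_real_deriv[OF s] \<gamma>i]
              has_vector_derivative_mult[OF has_vector_derivative_const of_real_deriv[OF S]]]])
        (simp add: s1u algebra_simps)
    then show ?thesis by (rule has_vector_derivative_at_within)
  qed
  then have "D t = D 0"
    using has_vector_derivative_zero_constant[of I D] I t is_interval_convex by metis
  then show ?thesis
    by (simp add: D_def init q_def algebra_simps)
qed

text \<open>The hypothesis at \<open>x(0)\<close> excludes \<open>k > 0\<close> with \<open>u(0) = 0\<close>, so \<open>s\<close> has no zero on the imaginary axis,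
and \<open>(x(0) + q S a)/s\<close> is an extension to the complement of the zeros of \<open>s\<close>.\<close>
lemma imaginary_complete_if:
  assumes *: "\<And>x. b a x = 0 \<Longrightarrow> b a a * b x x \<le> 0"
  shows "iR_complete (type_F_field a)"
  unfolding iR_complete_def
proof (intro allI impI)
  fix I \<gamma> assume tr: "trajectory (type_F_field a) I \<gamma>"
  obtain s s1 S where s: "\<And>z. (s has_field_derivative s1 z) (at z)"
    "\<And>z. (s1 has_field_derivative of_real (b a a * b (\<gamma> 0) (\<gamma> 0)) * s z) (at z)"
    "\<And>z. (S has_field_derivative s z) (at z)"
    "s 0 = 1" "s1 0 = of_real (b a (\<gamma> 0))" "S 0 = 0"
    and nz: "\<And>z. \<not> (b a a * b (\<gamma> 0) (\<gamma> 0) > 0 \<and> b a (\<gamma> 0) = 0) \<Longrightarrow> Re z = 0 \<Longrightarrow> s z \<noteq> 0"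
    using fundamental_solution_exists[of "b a a * b (\<gamma> 0) (\<gamma> 0)" "b a (\<gamma> 0)"] by metis
  define U where "U = {z. s z \<noteq> 0}"
  define F where "F = (\<lambda>z. (\<chi> i. (of_real (\<gamma> 0 $ i) + of_real (b (\<gamma> 0) (\<gamma> 0) * a $ i) * S z) / s z))"
  have hol: "s holomorphic_on T" "S holomorphic_on T" for T
    using s by (meson holomorphic_on_open DERIV_subset field_differentiable_def
        field_differentiable_at_within holomorphic_on_def)+
  have "open U"
    unfolding U_def using holomorphic_on_imp_continuous_on[OF hol(1)[of UNIV]]
    by (intro open_Collect_neq) auto
  moreover have "{z. Re z = 0} \<subseteq> U"
    using nz *[of "\<gamma> 0"] by (fastforce simp: U_def)
  moreover have "(\<lambda>z. F z $ i) holomorphic_on U" for i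
    unfolding F_def by (auto intro!: holomorphic_intros hol simp: U_def)
  moreover have "F (of_real t) $ i = of_real (\<gamma> t $ i)" if "t \<in> I" "of_real t \<in> U" for t i
    using trajectory_linearized[OF tr s that(1), of i] that(2)
    by (simp add: F_def U_def field_simps)
  ultimately show "\<exists>U F. open U \<and> {z. Re z = 0} \<subseteq> U \<and> (\<forall>i. (\<lambda>z. F z $ i) holomorphic_on U) \<and>
      (\<forall>t\<in>I. complex_of_real t \<in> U \<longrightarrow> (\<forall>i. F (of_real t) $ i = complex_of_real (\<gamma> t $ i)))"
    by blast
qed

text \<open>For \<open>x \<in> a\<^sup>\<bottom>\<close> with \<open>k = r\<^sup>2 > 0\<close> the linearization yields \<open>s = cosh(rt)\<close> and \<open>S = sinh(rt)/r\<close>, which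
gives this global trajectory through \<open>x\<close>. It is the witness of incompleteness.\<close>
lemma hyperbolic_trajectory:
  assumes x: "b a x = 0" and r: "r > 0" "b a a * b x x = r * r"
  shows "trajectory (type_F_field a) UNIV
     (\<lambda>t. inverse (cosh (r * t)) *\<^sub>R (x + (b x x / r * sinh (r * t)) *\<^sub>R a))"
proof -
  define q where "q = b x x"
  define C where "C = (\<lambda>t. cosh (r * t))"
  define H where "H = (\<lambda>t. sinh (r * t))"
  define \<gamma> where "\<gamma> = (\<lambda>t. inverse (C t) *\<^sub>R (x + (q / r * H t) *\<^sub>R a))"
  have C: "C t > 0" for t by (simp add: C_def)
  have CH: "H t * H t = C t * C t - 1" for t
    using cosh_square_eq[of "r * t"] by (simp add: C_def H_def power2_eq_square)
  have q: "q \<noteq> 0" using r by (auto simp: q_def)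
  then have baa: "b a a = r * r / q"
    using r by (simp add: q_def eq_divide_eq)
  have u: "b a (\<gamma> t) = r * H t / C t" for t
    using q r C[of t] by (simp add: \<gamma>_def scaleR_right add_right x baa field_simps)
  have e: "b (\<gamma> t) (\<gamma> t) = q" for t
  proof -
    have "b (\<gamma> t) (\<gamma> t) = inverse (C t) * inverse (C t) * (q + q * (H t * H t))"
      using q r by (simp add: \<gamma>_def scaleR_right scaleR_left add_right add_left x sym[of x a] baa)
        (use C[of t] in \<open>simp add: q_def[symmetric] field_simps flip: add_divide_distrib\<close>)
    then show ?thesis using C[of t] by (simp add: CH field_simps)
  qed
  have "(\<gamma> has_vector_derivative type_F_field a (\<gamma> t)) (at t)" for t
  proof -
    have "((\<lambda>t. inverse (C t)) has_real_derivative - (r * H t / (C t * C t))) (at t)"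
      unfolding C_def H_def using cosh_real_nonzero[of "r * t"]
      by (auto intro!: derivative_eq_intros simp: field_simps)
    moreover have "((\<lambda>t. x + (q / r * H t) *\<^sub>R a) has_vector_derivative (q * C t) *\<^sub>R a) (at t)"
      unfolding H_def C_def using r
      by (auto intro!: derivative_eq_intros simp: field_simps)
    ultimately have "(\<gamma> has_vector_derivative inverse (C t) *\<^sub>R ((q * C t) *\<^sub>R a) +
        - (r * H t / (C t * C t)) *\<^sub>R (x + (q / r * H t) *\<^sub>R a)) (at t)"
      unfolding \<gamma>_def by (rule has_vector_derivative_scaleR)
    also have "inverse (C t) *\<^sub>R ((q * C t) *\<^sub>R a) + - (r * H t / (C t * C t)) *\<^sub>R (x + (q / r * H t) *\<^sub>R a)
       = q *\<^sub>R a - (r * H t / C t) *\<^sub>R \<gamma> t"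
      using C[of t] by (simp add: \<gamma>_def field_simps)
    finally show ?thesis by (simp add: type_F_field_def e u)
  qed
  then show ?thesis
    by (simp add: trajectory_def \<gamma>_def[unfolded C_def H_def q_def])
qed

text \<open>A holomorphic extension \<open>F\<close> of the hyperbolic trajectory \<open>\<gamma>\<close> satisfies
\<open>cosh(rz) F(z) = \<gamma>(0) + (q/r) sinh(rz) a\<close> near 0 on the real axis, hence on the component of its
domain that contains the imaginary axis. At \<open>z = i\<pi>/(2r)\<close> the left side is 0, while the right side has
real part \<open>\<gamma>(0) \<noteq> 0\<close>.\<close>
lemma imaginary_complete_only_if:
  assumes comp: "iR_complete (type_F_field a)" and x: "b a x = 0"
  shows "b a a * b x x \<le> 0"
proof (rule ccontr)
  assume neg: "\<not> ?thesis"
  define r where "r = sqrt (b a a * b x x)"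
  have r: "r > 0" "b a a * b x x = r * r" using neg by (auto simp: r_def)
  have "x \<noteq> 0" using neg zero_left by auto
  then obtain i where xi: "x $ i \<noteq> 0" by (auto simp: vec_eq_iff)
  define \<gamma> where "\<gamma> = (\<lambda>t. inverse (cosh (r * t)) *\<^sub>R (x + (b x x / r * sinh (r * t)) *\<^sub>R a))"
  obtain U and F :: "complex \<Rightarrow> complex ^ 'n" where U: "open U" "{z. Re z = 0} \<subseteq> U"
    and F: "\<And>i. (\<lambda>z. F z $ i) holomorphic_on U"
    and F\<gamma>: "\<And>t i. of_real t \<in> U \<Longrightarrow> F (of_real t) $ i = of_real (\<gamma> t $ i)"
    using comp[unfolded iR_complete_def, rule_format,
        OF hyperbolic_trajectory[OF x r, folded \<gamma>_def]] by blast
  define K where "K = connected_component_set U 0"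
  have "0 \<in> U" using U(2) by auto
  have K: "open K" "connected K" "K \<subseteq> U" "0 \<in> K"
    using U \<open>0 \<in> U\<close> by (auto simp: K_def open_connected_component connected_component_subset)
  have iK: "{z. Re z = 0} \<subseteq> K"
    unfolding K_def
  proof (rule connected_component_maximal)
    show "connected {z. Re z = 0}"
      using convex_hyperplane[of "1::complex" 0] by (auto simp: inner_complex_def intro!: convex_connected)
  qed (use U in auto)
  define f where "f = (\<lambda>z. cosh (of_real r * z) * F z $ i)"
  define h where "h = (\<lambda>z::complex. of_real (x $ i) + of_real (b x x * a $ i / r) * sinh (of_real r * z))"
  define z0 where "z0 = \<i> * of_real (pi / (2 * r))"
  obtain d where d: "d > 0" "ball 0 d \<subseteq> K" using K openE by blast
  define T where "T = complex_of_real ` {-d<..<d}"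
  have TK: "T \<subseteq> K" using d by (fastforce simp: T_def ball_def)
  have "f z0 = h z0"
  proof -
    have hol: "(\<lambda>z. f z - h z) holomorphic_on K"
      unfolding f_def h_def cosh_field_def sinh_field_def
      by (intro holomorphic_intros holomorphic_on_subset[OF F] K(3)) auto
    have fh: "f z - h z = 0" if "z \<in> T" for z
    proof -
      from that obtain t where t: "z = of_real t" by (auto simp: T_def)
      have "complex_of_real (cosh (r * t)) \<noteq> 0" by simp
      then show ?thesis
        using F\<gamma>[of t i] that TK K
        by (auto simp: f_def h_def t \<gamma>_def field_simps
          simp flip: cosh_sinh_of_real)
    qed
    have lim: "0 islimpt T"
      unfolding islimpt_approachable
    proof (intro allI impI)
      fix e :: real assume "e > 0"
      then show "\<exists>z\<in>T. z \<noteq> 0 \<and> dist z 0 < e"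
        using d unfolding T_def
        by (intro bexI[OF _ imageI[of "min d e / 2"]]) (auto simp: min_def)
    qed
    have "z0 \<in> K" using iK by (auto simp: z0_def)
    then have "f z0 - h z0 = 0"
      using analytic_continuation[OF hol K(1,2) TK K(4) lim fh] by simp
    then show ?thesis by simp
  qed
  moreover have iz: "\<i> * (of_real r * z0) = of_real (- (pi / 2))"
    using r by (simp add: z0_def complex_eq_iff)
  have "cosh (of_real r * z0) = 0"
    by (simp only: cosh_conv_cos iz cos_of_real cos_minus) simp
  then have "f z0 = 0" by (simp add: f_def)
  moreover have "sinh (of_real r * z0) = \<i>"
    by (simp only: sinh_conv_sin iz sin_of_real sin_minus) simp
  then have "h z0 = of_real (x $ i) + of_real (b x x * a $ i / r) * \<i>" by (simp add: h_def)
  moreover have "Re (of_real p + of_real q * \<i>) = p" for p q by simp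
  ultimately show False using xi \<open>f z0 = h z0\<close> by (metis zero_complex.sel(1))
qed

end

section \<open>Brackets of type F\<close>

text \<open>For \<open>i \<noteq> j\<close> write \<open>[e\<^sub>i, e\<^sub>j] = c\<^sub>i\<^sub>j e\<^sub>i - c\<^sub>j\<^sub>i e\<^sub>j\<close>. Since \<open>[e\<^sub>i + e\<^sub>k, e\<^sub>j]\<close> is a combination of \<open>e\<^sub>i + e\<^sub>k\<close> and \<open>e\<^sub>j\<close>,
comparing the coefficients of \<open>e\<^sub>i\<close> and \<open>e\<^sub>k\<close> gives \<open>c\<^sub>i\<^sub>j = c\<^sub>k\<^sub>j\<close>; so \<open>c\<^sub>i\<^sub>j\<close> depends on \<open>j\<close> only, and is the value of
\<open>l\<close> at \<open>e\<^sub>j\<close>. In dimension one antisymmetry makes the bracket zero, and any \<open>l\<close> is suitable.\<close>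
lemma type_F_bracket_functional:
  fixes br :: "real ^ 'n::finite \<Rightarrow> real ^ 'n \<Rightarrow> real ^ 'n"
  assumes bil: "bilinear br" and anti: "\<And>x y. br x y = - br y x"
    and F: "\<And>x y. \<exists>\<alpha> \<beta>. br x y = \<alpha> *\<^sub>R x + \<beta> *\<^sub>R y"
  obtains l where "linear l" and "\<And>x y. br x y = l y *\<^sub>R x - l x *\<^sub>R y"
proof -
  define e where "e = (\<lambda>i::'n. axis i (1::real))"
  have e: "e i $ j = (if i = j then 1 else 0)" for i j
    by (simp add: e_def axis_def)
  define c where "c = (\<lambda>i j. br (e i) (e j) $ i)"
  have br: "br (e i) (e j) = c i j *\<^sub>R e i - c j i *\<^sub>R e j" if "i \<noteq> j" for i j
  proof -
    obtain \<alpha> \<beta> where *: "br (e i) (e j) = \<alpha> *\<^sub>R e i + \<beta> *\<^sub>R e j" using F by blast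
    have "c i j = \<alpha>" using that by (simp add: c_def * e)
    moreover have "c j i = - \<beta>" using that by (simp add: c_def anti[of "e j"] * e)
    ultimately show ?thesis by (simp add: *)
  qed
  have c_indep: "c i j = c k j" if ij: "i \<noteq> j" "k \<noteq> j" for i k j
  proof (cases "i = k")
    case False
    obtain \<alpha> \<beta> where *: "br (e i + e k) (e j) = \<alpha> *\<^sub>R (e i + e k) + \<beta> *\<^sub>R e j" using F by blast
    have **: "br (e i + e k) (e j) = br (e i) (e j) + br (e k) (e j)"
      by (rule bilinear_ladd[OF bil])
    have "c i j = \<alpha>"
      using arg_cong[OF *, of "\<lambda>v. v $ i"] False ij by (simp add: ** br e)
    moreover have "c k j = \<alpha>"
      using arg_cong[OF *, of "\<lambda>v. v $ k"] False ij by (simp add: ** br e)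
    ultimately show ?thesis by simp
  qed simp
  define L where "L = (\<chi> j. c (SOME i. i \<noteq> j) j)"
  have L: "c i j = L $ j" if "i \<noteq> j" for i j
    using c_indep[OF that someI[of "\<lambda>i. i \<noteq> j", OF that]] by (simp add: L_def)
  have lin: "linear (\<lambda>x. L \<bullet> x)"
    by (simp add: bounded_linear.linear bounded_linear_inner_right)
  have "br = (\<lambda>x y. (L \<bullet> y) *\<^sub>R x - (L \<bullet> x) *\<^sub>R y)"
  proof (rule bilinear_eq_stdbasis)
    show "bilinear (\<lambda>x y. (L \<bullet> y) *\<^sub>R x - (L \<bullet> x) *\<^sub>R y)"
      by (auto simp: bilinear_def algebra_simps intro!: linearI)
    fix x y :: "real ^ 'n" assume "x \<in> Basis" "y \<in> Basis"
    then obtain i j where ij: "x = e i" "y = e j"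
      by (auto simp: Basis_vec_def e_def)
    have "L \<bullet> e k = L $ k" for k by (simp add: e_def inner_axis)
    moreover have "br (e i) (e i) = 0"
      using anti[of "e i" "e i"] by (simp add: vec_eq_iff)
    ultimately show "br x y = (L \<bullet> y) *\<^sub>R x - (L \<bullet> x) *\<^sub>R y"
      by (cases "i = j") (auto simp: ij br L)
  qed (rule bil)
  then show ?thesis using that[OF lin] by metis
qed

text \<open>If \<open>l(y) = 0\<close> and \<open>l(x) = 1\<close>, then \<open>y = [y, x]\<close> is itself a bracket.\<close>
lemma span_type_F_brackets:
  fixes l :: "'v::real_vector \<Rightarrow> real"
  assumes l: "linear l" "l x0 \<noteq> 0"
  shows "span {l y *\<^sub>R x - l x *\<^sub>R y | x y. True} = {x. l x = 0}"
proof
  interpret linear l by (rule l)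
  show "span {l y *\<^sub>R x - l x *\<^sub>R y | x y. True} \<subseteq> {x. l x = 0}"
    by (rule span_minimal) (auto simp: diff scale linear_subspace_kernel[OF l(1)])
  show "{x. l x = 0} \<subseteq> span {l y *\<^sub>R x - l x *\<^sub>R y | x y. True}"
  proof clarify
    fix y assume y: "l y = 0"
    have "y = l (x0 /\<^sub>R l x0) *\<^sub>R y - l y *\<^sub>R (x0 /\<^sub>R l x0)"
      using l(2) y by (simp add: scale)
    then show "y \<in> span {l y *\<^sub>R x - l x *\<^sub>R y | x y. True}"
      by (blast intro: span_base)
  qed
qed

section \<open>Nondegenerate forms and orthogonal complements\<close>

locale nondegenerate_form = symmetric_form b for b :: "real ^ 'n::finite \<Rightarrow> real ^ 'n \<Rightarrow> real" +
  assumes nondegenerate: "(\<And>y. b x y = 0) \<Longrightarrow> x = 0"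
begin

text \<open>Nondegeneracy makes \<open>x \<mapsto> b(x, \<cdot>)\<close> injective, hence onto the dual space by dimension.\<close>
lemma functional_represented:
  assumes "linear l"
  obtains a where "\<And>z. b a z = l z"
proof -
  define f where "f = (\<lambda>x. \<chi> i. b x (axis i 1))"
  have ext: "h = h'" if "linear h" "linear h'" "\<And>i. h (axis i 1) = h' (axis i 1)"
    for h h' :: "real ^ 'n \<Rightarrow> real"
    by (rule linear_eq_stdbasis) (use that in \<open>auto simp: Basis_vec_def\<close>)
  have lin: "linear (b x)" for x
    by (simp add: bounded_linear.linear bounded_linear_right)
  have "linear f"
    by (auto intro!: linearI simp: f_def vec_eq_iff add_left scaleR_left)
  moreover have "inj f"
  proof (subst linear_injective_0[OF \<open>linear f\<close>], intro allI impI)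
    fix x assume "f x = 0"
    then have "b x = (\<lambda>_. 0)"
      by (intro ext lin) (auto simp: f_def vec_eq_iff intro!: linearI)
    then show "x = 0" by (intro nondegenerate) metis
  qed
  ultimately obtain a where "f a = (\<chi> i. l (axis i 1))"
    using linear_inj_imp_surj by (metis surjD)
  then have "b a = l"
    by (intro ext lin assms) (auto simp: f_def vec_eq_iff)
  then show ?thesis using that by metis
qed

lemma form_split_along:
  assumes "b a a \<noteq> 0"
  obtains y where "b a y = 0" and "z = (b a z / b a a) *\<^sub>R a + y"
    and "b z z = b a z * b a z / b a a + b y y"
proof
  let ?y = "z - (b a z / b a a) *\<^sub>R a"
  show y: "b a ?y = 0" using assms by (simp add: diff_right scaleR_right)
  show "z = (b a z / b a a) *\<^sub>R a + ?y" by simp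
  show "b z z = b a z * b a z / b a a + b ?y ?y"
    using assms by (simp add: diff_right scaleR_right diff_left scaleR_left sym[of z a])
qed

text \<open>A vector of \<open>a\<^sup>\<bottom>\<close> is orthogonal to \<open>a\<close>; if it is also orthogonal to \<open>a\<^sup>\<bottom>\<close>, it is orthogonal to everything.\<close>
lemma perp_radical_trivial:
  assumes c: "b a a \<noteq> 0" and x: "b a x = 0" "\<And>y. b a y = 0 \<Longrightarrow> b x y = 0"
  shows "x = 0"
proof (rule nondegenerate)
  fix z
  obtain y where "b a y = 0" "z = (b a z / b a a) *\<^sub>R a + y"
    using form_split_along[OF c] by blast
  then have "b x z = (b a z / b a a) * b x a + b x y"
    by (metis add_right scaleR_right real_scaleR_def)
  then show "b x z = 0" using x \<open>b a y = 0\<close> sym[of x a] by simp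
qed

text \<open>If \<open>b(a, a) = 0\<close>, then \<open>a\<close> itself is a radical vector of \<open>a\<^sup>\<bottom>\<close>; otherwise \<open>a\<close> and \<open>a\<^sup>\<bottom>\<close> span the space.\<close>
lemma degenerate_on_perp_iff:
  assumes "a \<noteq> 0"
  shows "degenerate_on {x. b a x = 0} b \<longleftrightarrow> b a a = 0"
proof
  assume "b a a = 0"
  then show "degenerate_on {x. b a x = 0} b"
    using assms by (auto simp: degenerate_on_def)
next
  assume "degenerate_on {x. b a x = 0} b"
  then show "b a a = 0"
    using perp_radical_trivial[of a] by (auto simp: degenerate_on_def)
qed

text \<open>Let \<open>b(a, a) \<noteq> 0\<close>. A semidefinite form is zero only on its radical, and \<open>a\<^sup>\<bottom>\<close> has trivial radical, so
the sign condition makes \<open>b\<close> definite on \<open>a\<^sup>\<bottom>\<close>; the vectors \<open>a\<close> and \<open>y0\<close> have opposite signs. Conversely, if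
\<open>b\<close> were definite on \<open>a\<^sup>\<bottom>\<close> with the sign of \<open>b(a, a)\<close>, it would be definite on the whole space.\<close>
lemma perp_sign_condition_iff:
  assumes "a \<noteq> 0" and y0: "b a y0 = 0" "y0 \<noteq> 0"
  shows "(\<forall>x. b a x = 0 \<longrightarrow> b a a * b x x \<le> 0) \<longleftrightarrow>
    degenerate_on {x. b a x = 0} b \<or> (definite_on {x. b a x = 0} b \<and> indefinite_on UNIV b)"
proof (cases "b a a = 0")
  case True
  then show ?thesis using degenerate_on_perp_iff[OF assms(1)] by simp
next
  case c: False
  have "definite_on {x. b a x = 0} b \<and> indefinite_on UNIV b"
    if le: "\<And>x. b a x = 0 \<Longrightarrow> b a a * b x x \<le> 0"
  proof -
    have less: "b a a * b x x < 0" if x: "b a x = 0" "x \<noteq> 0" for x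
    proof (rule ccontr)
      assume "\<not> ?thesis"
      with le[OF x(1)] c have xx: "b x x = 0" by (metis mult_eq_0_iff order_le_less)
      have "b x y = 0" if y: "b a y = 0" for y
      proof (rule ccontr)
        assume xy: "b x y \<noteq> 0"
        define k where "k = b a a * b y y"
        \<comment> \<open>chosen such that \<open>b a a * b (t *\<^sub>R x + y) (t *\<^sub>R x + y) = 1\<close>, as \<open>b x x = 0\<close>\<close>
        define t where "t = (1 - k) / (2 * (b a a * b x y))"
        have "b a (t *\<^sub>R x + y) = 0" using x y by (simp add: add_right scaleR_right)
        from le[OF this] have "2 * t * (b a a * b x y) + k \<le> 0"
          by (simp add: add_right scaleR_right add_left scaleR_left xx sym[of y x] k_def algebra_simps)
        moreover have "2 * t * (b a a * b x y) = 1 - k"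
          using c xy by (simp add: t_def)
        ultimately show False by simp
      qed
      then show False using perp_radical_trivial[OF c x(1)] x(2) by blast
    qed
    show ?thesis
    proof (cases "b a a > 0")
      case True
      then have "b x x < 0" if "b a x = 0" "x \<noteq> 0" for x
        using less[OF that] by (simp add: mult_less_0_iff)
      then show ?thesis
        using True y0 unfolding definite_on_def indefinite_on_def by blast
    next
      case False
      then have "b a a < 0" using c by simp
      moreover from this have "b x x > 0" if "b a x = 0" "x \<noteq> 0" for x
        using less[OF that] by (simp add: mult_less_0_iff)
      ultimately show ?thesis
        using y0 unfolding definite_on_def indefinite_on_def by blast
    qed
  qed
  moreover have "b a a * b x x \<le> 0"
    if d: "definite_on {x. b a x = 0} b" and i: "indefinite_on UNIV b" and x: "b a x = 0" for x
  proof (rule ccontr)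
    assume xx: "\<not> ?thesis"
    then have "x \<noteq> 0" using zero_left by auto
    have pos: "b a a * b y y \<ge> 0" if y: "b a y = 0" for y
    proof (cases "y = 0")
      case False
      from d x \<open>x \<noteq> 0\<close> y False
      have "(b x x > 0 \<and> b y y > 0) \<or> (b x x < 0 \<and> b y y < 0)"
        unfolding definite_on_def by blast
      then show ?thesis using xx by (auto simp: not_le zero_less_mult_iff zero_le_mult_iff)
    qed (simp add: zero_left)
    have "b a a * b z z \<ge> 0" for z
    proof -
      obtain y where y: "b a y = 0" "b z z = b a z * b a z / b a a + b y y"
        using form_split_along[OF c] by blast
      then have "b a a * b z z = b a z * b a z + b a a * b y y" using c by (simp add: field_simps)
      then show ?thesis using pos[OF y(1)] by simp
    qed
    moreover obtain z1 z2 where "b z1 z1 > 0" "b z2 z2 < 0"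
      using i unfolding indefinite_on_def by blast
    moreover have "b a a > 0 \<or> b a a < 0" using c by linarith
    ultimately show False by (meson mult_neg_pos mult_pos_neg not_le)
  qed
  ultimately show ?thesis
    using degenerate_on_perp_iff[OF assms(1)] c by blast
qed

text \<open>The right side of the hypothesis equals \<open>b(b(x, x) a - b(a, x) x, z)\<close>.\<close>
lemma eq_type_F_field:
  assumes a: "\<And>z. b a z = l z"
    and W: "\<And>z. b w z = b x (l z *\<^sub>R x - l x *\<^sub>R z)"
  shows "w = type_F_field a x"
proof -
  have "w - type_F_field a x = 0"
    by (rule nondegenerate)
      (simp add: type_F_field_def diff_left diff_right scaleR_left scaleR_right W a)
  then show ?thesis by simp
qed

end

section \<open>Tangent spaces\<close>

lemma Ck_on_const: "Ck_on k S (\<lambda>_. c)"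
  by (induction k arbitrary: c) (simp_all add: frechet_derivative_const)

lemma smooth_fun_const: "smooth_fun A (\<lambda>_. c)"
  by (auto simp: smooth_fun_def smooth_on_def o_def Ck_on_const)

lemma smooth_on_imp_differentiable:
  assumes "smooth_on S f" "x \<in> S"
  shows "f differentiable (at x)"
proof -
  have "Ck_on (Suc 0) S f" using assms by (simp only: smooth_on_def)
  then show ?thesis using assms(2) by simp
qed

lemma tangent_const: "u \<in> tangent_space A p \<Longrightarrow> u (\<lambda>_. c) = 0"
  by (auto simp: tangent_space_def chart_tangent_def o_def frechet_derivative_const)

lemma left_translate_zero: "left_translate A p 0 = 0"
  by (auto simp: left_translate_def fun_eq_iff)

context
  fixes A :: "('p::topological_space, 'n::finite) atlas"
  assumes A: "smooth_atlas A"
begin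

lemma chart_inv:
  assumes "(U, \<phi>) \<in> A" "p \<in> U"
  shows "inv_into U \<phi> (\<phi> p) = p"
  using A assms by (fastforce simp: smooth_atlas_def homeomorphism_def)

lemma open_chart_image_Int:
  assumes "(U, \<phi>) \<in> A" "(V, \<psi>) \<in> A"
  shows "open (\<phi> ` (U \<inter> V))"
proof -
  have "homeomorphism U (\<phi> ` U) \<phi> (inv_into U \<phi>)" "open U" "open V" "open (\<phi> ` U)"
    using A assms by (auto simp: smooth_atlas_def)
  then show ?thesis
    using homeomorphism_imp_open_map[of U "\<phi> ` U" \<phi> _ "U \<inter> V"]
    by (metis openin_open_Int openin_open_eq)
qed

text \<open>By the chain rule for the transition map. Consequently a single chart at \<open>p\<close> parametrizes the tangent
space, which is therefore a vector space.\<close>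
lemma chart_tangent_change:
  assumes U: "(U, \<phi>) \<in> A" and V: "(V, \<psi>) \<in> A" and p: "p \<in> U" "p \<in> V"
  shows "chart_tangent A (U, \<phi>) p v =
    chart_tangent A (V, \<psi>) p (frechet_derivative (\<psi> \<circ> inv_into U \<phi>) (at (\<phi> p)) v)"
proof
  fix f
  show "chart_tangent A (U, \<phi>) p v f =
    chart_tangent A (V, \<psi>) p (frechet_derivative (\<psi> \<circ> inv_into U \<phi>) (at (\<phi> p)) v) f"
  proof (cases "smooth_fun A f")
    case True
    let ?t = "\<psi> \<circ> inv_into U \<phi>" and ?f = "f \<circ> inv_into V \<psi>"
    have tp: "?t (\<phi> p) = \<psi> p" using chart_inv[OF U p(1)] by simp
    have "smooth_on (\<phi> ` (U \<inter> V)) ?t"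
      using A U V by (fastforce simp: smooth_atlas_def)
    then have t: "?t differentiable (at (\<phi> p))"
      by (rule smooth_on_imp_differentiable) (use p in auto)
    have "smooth_on (\<psi> ` V) ?f"
      using True V by (fastforce simp: smooth_fun_def)
    then have f: "?f differentiable (at (?t (\<phi> p)))"
      unfolding tp by (rule smooth_on_imp_differentiable) (use p in auto)
    have "((?f \<circ> ?t) has_derivative (frechet_derivative ?f (at (\<psi> p)) \<circ> frechet_derivative ?t (at (\<phi> p))))
        (at (\<phi> p))"
      using diff_chain_at[of ?t _ "\<phi> p" ?f] t f tp
      by (metis frechet_derivative_works)
    then have "((f \<circ> inv_into U \<phi>) has_derivative
        (frechet_derivative ?f (at (\<psi> p)) \<circ> frechet_derivative ?t (at (\<phi> p)))) (at (\<phi> p))"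
      by (rule has_derivative_transform_within_open[OF _ open_chart_image_Int[OF U V]])
        (use p chart_inv[OF U] chart_inv[OF V] in auto)
    then have "frechet_derivative (f \<circ> inv_into U \<phi>) (at (\<phi> p)) =
      frechet_derivative ?f (at (\<psi> p)) \<circ> frechet_derivative ?t (at (\<phi> p))"
      by (metis frechet_derivative_at)
    then show ?thesis using True by (simp add: chart_tangent_def)
  qed (simp add: chart_tangent_def)
qed

lemma tangent_space_eq_range:
  assumes "c \<in> A" "p \<in> fst c"
  shows "tangent_space A p = range (chart_tangent A c p)"
proof -
  obtain V \<psi> where c: "c = (V, \<psi>)" by (cases c)
  show ?thesis
    unfolding tangent_space_def
  proof (intro equalityI subsetI)
    fix u assume "u \<in> {chart_tangent A c p v |c v. c \<in> A \<and> p \<in> fst c}"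
    then obtain U \<phi> v where "(U, \<phi>) \<in> A" "p \<in> U" "u = chart_tangent A (U, \<phi>) p v" by force
    then show "u \<in> range (chart_tangent A c p)"
      using chart_tangent_change[of U \<phi> V \<psi> p v] assms c by auto
  qed (use assms in blast)
qed

lemma linear_chart_tangent:
  assumes "c \<in> A" "p \<in> fst c"
  shows "linear (chart_tangent A c p)"
proof -
  obtain U \<phi> where c: "c = (U, \<phi>)" by (cases c)
  have lin: "linear (frechet_derivative (f \<circ> inv_into U \<phi>) (at (\<phi> p)))" if "smooth_fun A f" for f
  proof -
    have "smooth_on (\<phi> ` U) (f \<circ> inv_into U \<phi>)"
      using that assms c by (fastforce simp: smooth_fun_def)
    then show ?thesis
      by (intro linear_frechet_derivative smooth_on_imp_differentiable) (use assms c in auto)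
  qed
  show ?thesis
    by (intro linearI)
      (auto simp: fun_eq_iff c chart_tangent_def scaleR_fun_def linear_add[OF lin] linear_scale[OF lin])
qed

lemma chart_exists:
  obtains c where "c \<in> A" "p \<in> fst c"
proof -
  have "p \<in> (\<Union>(U, \<phi>)\<in>A. U)" using A by (simp add: smooth_atlas_def)
  then show ?thesis using that by force
qed

lemma subspace_tangent_space: "subspace (tangent_space A p)"
  using chart_exists[of p] tangent_space_eq_range linear_chart_tangent
  by (metis linear_subspace_image subspace_UNIV)

end

section \<open>The Euler-Arnold field in coordinates of the Lie algebra\<close>

locale left_invariant_geometry =
  fixes A :: "('p::{topological_group_add, t2_space, second_countable_topology}, 'n::finite) atlas"
    and g :: "'p \<Rightarrow> 'p tangent \<Rightarrow> 'p tangent \<Rightarrow> real"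
    and nabla :: "'p vfield \<Rightarrow> 'p vfield \<Rightarrow> 'p vfield"
    and \<iota> :: "real ^ 'n \<Rightarrow> 'p vfield"
  assumes G: "lie_group A" and F: "type_F_group A"
    and pr: "pseudo_riemannian A g" and li: "left_invariant_metric A g"
    and lc: "levi_civita_connection A g nabla"
    and lin: "linear \<iota>" and bij: "bij_betw \<iota> UNIV (lie_algebra A)"
begin

lemma atlas: "smooth_atlas A"
  using G by (simp add: lie_group_def)

lemma inj: "inj \<iota>" and range: "range \<iota> = lie_algebra A"
  using bij by (auto simp: bij_betw_def)

lemma inv_iota [simp]: "inv \<iota> (\<iota> x) = x"
  using inj by simp

lemma iota_in [simp]: "\<iota> x \<in> lie_algebra A"
  using range by auto

lemma invariant_field_eq: "X \<in> lie_algebra A \<Longrightarrow> X p = left_translate A p (X 0)"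
  unfolding lie_algebra_def by (metis (mono_tags, lifting) add.right_neutral mem_Collect_eq)

lemma vector_field_iota [simp]: "vector_field A (\<iota> x)"
  using iota_in[of x] by (simp only: lie_algebra_def) simp

lemma iota_tangent [simp]: "\<iota> x p \<in> tangent_space A p"
  using vector_field_iota[of x] by (simp add: vector_field_def)

lemma linear_iota_at: "linear (\<lambda>x. \<iota> x p)"
  by (auto intro!: linearI simp: linear_add[OF lin] linear_scale[OF lin] scaleR_fun_def)

lemma iota_at_unit_eq_0_iff: "\<iota> x 0 = 0 \<longleftrightarrow> x = 0"
proof
  assume "\<iota> x 0 = 0"
  then have "\<iota> x p = 0" for p
    using invariant_field_eq[OF iota_in, of x p] left_translate_zero by metis
  then have "\<iota> x = 0" by (intro ext) (simp add: zero_fun_def)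
  then show "x = 0"
    using inj linear_0[OF lin] by (metis injD)
qed (simp add: linear_0[OF lin])

text \<open>Every tangent vector at the unit extends to a left-invariant field. Evaluation at the unit is injective
on the Lie algebra, which has dimension \<open>n\<close>, while a chart map \<open>T\<close> presents the tangent space as an image of
\<open>\<real>\<^sup>n\<close>. The evaluation factors as \<open>T \<circ> M\<close> with a linear \<open>M\<close> on \<open>\<real>\<^sup>n\<close>; \<open>M\<close> is injective, hence surjective, so
evaluation has the same range as \<open>T\<close>. Counting dimensions takes the place of an argument from the
smoothness of the multiplication.\<close>
lemma tangent_space_unit: "tangent_space A 0 = range (\<lambda>x. \<iota> x 0)"
proof -
  obtain c where c: "c \<in> A" "0 \<in> fst c" using chart_exists[OF atlas] .
  define T where "T = chart_tangent A c 0"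
  have T: "tangent_space A 0 = range T" "linear T"
    using tangent_space_eq_range[OF atlas c] linear_chart_tangent[OF atlas c] by (auto simp: T_def)
  have "\<forall>i. \<exists>v. \<iota> (axis i 1) 0 = T v"
    using T(1) iota_tangent[of _ 0] by blast
  then obtain m where m: "\<And>i. \<iota> (axis i 1) 0 = T (m i)" by metis
  define M where "M = (\<lambda>x::real ^ 'n. \<Sum>i\<in>UNIV. x $ i *\<^sub>R m i)"
  have M: "linear M"
    by (auto intro!: linearI simp: M_def scaleR_left_distrib sum.distrib scaleR_sum_right)
  have TM: "\<iota> x 0 = T (M x)" for x
  proof -
    have "T (M x) = (\<Sum>i\<in>UNIV. x $ i *\<^sub>R \<iota> (axis i 1) 0)"
      by (simp add: M_def linear_sum[OF T(2)] linear_scale[OF T(2)] m)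
    also have "\<dots> = \<iota> (\<Sum>i\<in>UNIV. x $ i *\<^sub>R axis i 1) 0"
      by (simp add: linear_sum[OF linear_iota_at] linear_scale[OF linear_iota_at])
    also have "(\<Sum>i\<in>UNIV. x $ i *\<^sub>R axis i 1) = x"
      using basis_expansion[of x] by (simp add: scalar_mult_eq_scaleR)
    finally show ?thesis ..
  qed
  have "inj M"
    unfolding linear_injective_0[OF M]
    using TM linear_0[OF T(2)] iota_at_unit_eq_0_iff by metis
  then have "surj M" by (rule linear_inj_imp_surj[OF M])
  then have "range T = range (\<lambda>x. T (M x))" by (metis image_image)
  then show ?thesis by (simp add: T(1) TM)
qed

text \<open>Scalar products of left-invariant fields are constant, so their derivatives in the compatibility
condition of the connection vanish.\<close>
lemma metric_constant:
  "g p (\<iota> x p) (\<iota> y p) = g 0 (\<iota> x 0) (\<iota> y 0)"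
proof -
  have "g (p + 0) (left_translate A p (\<iota> x 0)) (left_translate A p (\<iota> y 0)) = g 0 (\<iota> x 0) (\<iota> y 0)"
    using li iota_tangent unfolding left_invariant_metric_def by blast
  then show ?thesis
    using invariant_field_eq[OF iota_in] by (metis add.right_neutral)
qed

definition metric_form :: "real ^ 'n \<Rightarrow> real ^ 'n \<Rightarrow> real" where
  "metric_form x y = metric_at_unit g (\<iota> x) (\<iota> y)"

lemma metric_form_sym: "metric_form x y = metric_form y x"
  using pr by (simp add: metric_form_def metric_at_unit_def pseudo_riemannian_def)

lemma g_combine:
  assumes "u \<in> tangent_space A 0" "v \<in> tangent_space A 0" "w \<in> tangent_space A 0"
  shows "g 0 (r *\<^sub>R u + s *\<^sub>R v) w = r * g 0 u w + s * g 0 v w"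
  using pr assms unfolding pseudo_riemannian_def by blast

lemma nondegenerate_metric_form: "nondegenerate_form metric_form"
proof (intro nondegenerate_form.intro symmetric_form.intro nondegenerate_form_axioms.intro)
  have lin_form: "linear (\<lambda>x. metric_form x y)" for y
  proof (rule linearI)
    show "metric_form (x + x') y = metric_form x y + metric_form x' y" for x x'
      using g_combine[of "\<iota> x 0" "\<iota> x' 0" "\<iota> y 0" 1 1]
      by (simp add: metric_form_def metric_at_unit_def linear_add[OF lin])
    show "metric_form (r *\<^sub>R x) y = r *\<^sub>R metric_form x y" for r x
      using g_combine[of "\<iota> x 0" "\<iota> x 0" "\<iota> y 0" r 0]
      by (simp add: metric_form_def metric_at_unit_def linear_scale[OF lin] scaleR_fun_def[of r "\<iota> x"])
  qed
  moreover have "linear (metric_form x)" for x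
  proof -
    have "metric_form x = (\<lambda>y. metric_form y x)" by (intro ext metric_form_sym)
    then show ?thesis using lin_form[of x] by simp
  qed
  ultimately show "bounded_bilinear metric_form"
    by (simp add: bilinear_def bilinear_conv_bounded_bilinear[symmetric])
  show "metric_form x y = metric_form y x" for x y by (rule metric_form_sym)
  show "x = 0" if "\<And>y. metric_form x y = 0" for x
  proof -
    have "\<forall>v\<in>tangent_space A 0. g 0 (\<iota> x 0) v = 0"
      using that by (auto simp: tangent_space_unit metric_form_def metric_at_unit_def)
    then have "\<iota> x 0 = 0"
      using pr iota_tangent[of x 0] unfolding pseudo_riemannian_def by blast
    then show ?thesis by (simp add: iota_at_unit_eq_0_iff)
  qed
qed

lemma nabla_field: "vector_field A (nabla (\<iota> x) (\<iota> y))"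
  using lc by (simp add: levi_civita_connection_def affine_connection_def)

lemma torsion_free: "lie_bracket (\<iota> x) (\<iota> y) = nabla (\<iota> x) (\<iota> y) - nabla (\<iota> y) (\<iota> x)"
  using lc by (simp add: levi_civita_connection_def)

lemma compatible: "g 0 (nabla (\<iota> x) (\<iota> y) 0) (\<iota> z 0) + g 0 (\<iota> y 0) (nabla (\<iota> x) (\<iota> z) 0) = 0"
proof -
  have "\<iota> x 0 (\<lambda>q. g q (\<iota> y q) (\<iota> z q)) =
      g 0 (nabla (\<iota> x) (\<iota> y) 0) (\<iota> z 0) + g 0 (\<iota> y 0) (nabla (\<iota> x) (\<iota> z) 0)"
    using lc by (simp add: levi_civita_connection_def)
  moreover have "(\<lambda>q. g q (\<iota> y q) (\<iota> z q)) = (\<lambda>_. g 0 (\<iota> y 0) (\<iota> z 0))"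
    by (intro ext metric_constant)
  ultimately show ?thesis by (simp only: tangent_const[OF iota_tangent])
qed

lemma nabla_at_unit: "nabla (\<iota> x) (\<iota> y) 0 \<in> tangent_space A 0"
  using nabla_field by (simp add: vector_field_def)

text \<open>The Koszul formula in the case \<open>X = Y\<close>:
\<open>-g(\<nabla>\<^sub>x x, z) = g(x, \<nabla>\<^sub>x z) = g(x, [x, z]) + g(x, \<nabla>\<^sub>z x)\<close>, and \<open>g(x, \<nabla>\<^sub>z x) = 0\<close> as \<open>g(x, x)\<close> is constant.\<close>
lemma nabla_self_metric:
  "g 0 (- nabla (\<iota> x) (\<iota> x) 0) (\<iota> z 0) = g 0 (\<iota> x 0) (lie_bracket (\<iota> x) (\<iota> z) 0)"
proof -
  let ?N = "\<lambda>x y. nabla (\<iota> x) (\<iota> y) 0"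
  have sym: "g 0 u v = g 0 v u" if "u \<in> tangent_space A 0" "v \<in> tangent_space A 0" for u v
    using pr[unfolded pseudo_riemannian_def, THEN conjunct1] that by blast
  have bracket: "lie_bracket (\<iota> x) (\<iota> z) 0 = 1 *\<^sub>R ?N x z + (- 1) *\<^sub>R ?N z x"
    by (simp add: torsion_free)
  then have "lie_bracket (\<iota> x) (\<iota> z) 0 \<in> tangent_space A 0"
    by (simp only:) (intro subspace_add subspace_scale nabla_at_unit subspace_tangent_space[OF atlas])
  then have "g 0 (\<iota> x 0) (lie_bracket (\<iota> x) (\<iota> z) 0) = g 0 (lie_bracket (\<iota> x) (\<iota> z) 0) (\<iota> x 0)"
    by (rule sym[OF iota_tangent])
  also have "\<dots> = g 0 (?N x z) (\<iota> x 0) - g 0 (?N z x) (\<iota> x 0)"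
    unfolding bracket by (subst g_combine) (simp_all add: nabla_at_unit)
  also have "g 0 (?N z x) (\<iota> x 0) = 0"
    using compatible[of z x x] sym[of "\<iota> x 0" "?N z x"] by (simp add: nabla_at_unit)
  also have "g 0 (?N x z) (\<iota> x 0) = - g 0 (?N x x) (\<iota> z 0)"
    using compatible[of x x z] sym[of "\<iota> x 0" "?N x z"] by (simp add: nabla_at_unit)
  also have "- g 0 (?N x x) (\<iota> z 0) = g 0 (- ?N x x) (\<iota> z 0)"
    using g_combine[of "?N x x" "?N x x" "\<iota> z 0" "-1" 0] by (simp add: nabla_at_unit)
  finally show ?thesis by simp
qed

definition bracket :: "real ^ 'n \<Rightarrow> real ^ 'n \<Rightarrow> real ^ 'n" where
  "bracket x y = inv \<iota> (lie_bracket (\<iota> x) (\<iota> y))"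

lemma type_F: "\<exists>\<alpha> \<beta>. lie_bracket (\<iota> x) (\<iota> y) = \<iota> (\<alpha> *\<^sub>R x + \<beta> *\<^sub>R y)"
proof -
  have "\<exists>\<alpha> \<beta>. lie_bracket (\<iota> x) (\<iota> y) = \<alpha> *\<^sub>R \<iota> x + \<beta> *\<^sub>R \<iota> y"
    using F unfolding type_F_group_def type_F_algebra_def by (meson iota_in)
  then show ?thesis by (simp add: linear_add[OF lin] linear_scale[OF lin])
qed

lemma iota_bracket: "\<iota> (bracket x y) = lie_bracket (\<iota> x) (\<iota> y)"
  using type_F[of x y] by (auto simp: bracket_def)

lemma bracket_anti: "bracket x y = - bracket y x"
proof -
  have "\<iota> (bracket x y) = - \<iota> (bracket y x)"
    by (simp add: iota_bracket lie_bracket_def fun_eq_iff)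
  also have "\<dots> = \<iota> (- bracket y x)" by (simp add: linear_neg[OF lin])
  finally show ?thesis using inj by (metis injD)
qed

text \<open>Torsion-freeness expresses the bracket by the connection, so its linearity in one argument comes from
the axioms of a connection, applied to constant functions in the case of scalars.\<close>
lemma bilinear_bracket: "bilinear bracket"
proof -
  have aff: "affine_connection A nabla" using lc by (simp add: levi_civita_connection_def)
  have *: "linear (\<lambda>x. bracket x y)" for y
  proof (rule linearI)
    fix x x'
    have "nabla (\<iota> x + \<iota> x') (\<iota> y) = nabla (\<iota> x) (\<iota> y) + nabla (\<iota> x') (\<iota> y)"
      "nabla (\<iota> y) (\<iota> x + \<iota> x') = nabla (\<iota> y) (\<iota> x) + nabla (\<iota> y) (\<iota> x')"
      using aff by (simp_all add: affine_connection_def)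
    then have "\<iota> (bracket (x + x') y) = \<iota> (bracket x y + bracket x' y)"
      using torsion_free[of "x + x'" y] torsion_free[of x y] torsion_free[of x' y]
      by (simp add: iota_bracket linear_add[OF lin])
    then show "bracket (x + x') y = bracket x y + bracket x' y" using inj by (metis injD)
  next
    fix r x
    have "nabla (\<lambda>p. r *\<^sub>R \<iota> x p) (\<iota> y) = (\<lambda>p. r *\<^sub>R nabla (\<iota> x) (\<iota> y) p)"
      "nabla (\<iota> y) (\<lambda>p. r *\<^sub>R \<iota> x p) =
        (\<lambda>p. \<iota> y p (\<lambda>_. r) *\<^sub>R \<iota> x p + r *\<^sub>R nabla (\<iota> y) (\<iota> x) p)"
      using aff smooth_fun_const[of A r] vector_field_iota unfolding affine_connection_def by blast+
    then have "nabla (r *\<^sub>R \<iota> x) (\<iota> y) = r *\<^sub>R nabla (\<iota> x) (\<iota> y)"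
      "nabla (\<iota> y) (r *\<^sub>R \<iota> x) = r *\<^sub>R nabla (\<iota> y) (\<iota> x)"
      by (simp_all add: tangent_const[OF iota_tangent] scaleR_fun_def[of r "_ :: 'p vfield"])
    then have "\<iota> (bracket (r *\<^sub>R x) y) = \<iota> (r *\<^sub>R bracket x y)"
      using torsion_free[of "r *\<^sub>R x" y] torsion_free[of x y]
      by (simp add: iota_bracket linear_scale[OF lin] scaleR_diff_right)
    then show "bracket (r *\<^sub>R x) y = r *\<^sub>R bracket x y" using inj by (metis injD)
  qed
  have "linear (bracket x)" for x
  proof -
    have "bracket x = (\<lambda>y. - bracket y x)" by (intro ext bracket_anti)
    then show ?thesis using linear_compose_neg[OF *[of x]] by simp
  qed
  with * show ?thesis by (simp add: bilinear_def)
qed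

lemma bracket_nonzero: "\<exists>x y. bracket x y \<noteq> 0"
proof -
  obtain X Y where "X \<in> lie_algebra A" "Y \<in> lie_algebra A" "lie_bracket X Y \<noteq> 0"
    using F by (auto simp: type_F_group_def type_F_algebra_def)
  then obtain x y where "lie_bracket (\<iota> x) (\<iota> y) \<noteq> 0" by (auto simp flip: range)
  then show ?thesis using iota_bracket[of x y] linear_0[OF lin] by metis
qed

lemma derived_algebra_eq: "derived_algebra A = \<iota> ` span {bracket x y | x y. True}"
proof -
  have "{lie_bracket X Y | X Y. X \<in> lie_algebra A \<and> Y \<in> lie_algebra A} = \<iota> ` {bracket x y | x y. True}"
    by (force simp: iota_bracket simp flip: range)
  then show ?thesis by (simp add: derived_algebra_def span_linear_image[OF lin])
qed

definition euler_field :: "real ^ 'n \<Rightarrow> real ^ 'n" where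
  "euler_field x = inv \<iota> (euler_arnold A nabla (\<iota> x))"

text \<open>The field represents \<open>-(\<nabla>\<^sub>x x)\<^sub>e\<close>, because this tangent vector is the value at the unit of a
left-invariant field, which is recovered by left translation.\<close>
lemma metric_euler_field: "metric_form (euler_field x) z = metric_form x (bracket x z)"
proof -
  have "- nabla (\<iota> x) (\<iota> x) 0 \<in> tangent_space A 0"
    by (intro subspace_neg subspace_tangent_space[OF atlas] nabla_at_unit)
  then obtain y where y: "- nabla (\<iota> x) (\<iota> x) 0 = \<iota> y 0"
    unfolding tangent_space_unit by blast
  then have "euler_arnold A nabla (\<iota> x) = \<iota> y"
    using invariant_field_eq[OF iota_in, of y] by (intro ext) (metis euler_arnold_def)
  then have "euler_field x = y" by (simp add: euler_field_def)
  then show ?thesis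
    using nabla_self_metric[of x z] by (simp add: metric_form_def metric_at_unit_def iota_bracket y)
qed

lemma transport:
  "degenerate_on (\<iota> ` S) (metric_at_unit g) = degenerate_on S metric_form"
  "definite_on (\<iota> ` S) (metric_at_unit g) = definite_on S metric_form"
  "indefinite_on (\<iota> ` S) (metric_at_unit g) = indefinite_on S metric_form"
proof -
  have "\<iota> x = 0 \<longleftrightarrow> x = 0" for x using inj linear_0[OF lin] by (metis injD)
  then show "degenerate_on (\<iota> ` S) (metric_at_unit g) = degenerate_on S metric_form"
  "definite_on (\<iota> ` S) (metric_at_unit g) = definite_on S metric_form"
  "indefinite_on (\<iota> ` S) (metric_at_unit g) = indefinite_on S metric_form"
    by (auto simp: degenerate_on_def definite_on_def indefinite_on_def metric_form_def)
qed

end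

section \<open>Completeness along the imaginary axis\<close>

theorem theorem9p5:
  fixes A :: "('p::{topological_group_add, t2_space, second_countable_topology}, 'n::finite) atlas"
    and g :: "'p \<Rightarrow> 'p tangent \<Rightarrow> 'p tangent \<Rightarrow> real"
    and nabla :: "'p vfield \<Rightarrow> 'p vfield \<Rightarrow> 'p vfield"
    and \<iota> :: "real ^ 'n \<Rightarrow> 'p vfield"
  assumes "lie_group A"
    and "type_F_group A"
    and "pseudo_riemannian A g"
    and "left_invariant_metric A g"
    and "levi_civita_connection A g nabla"
    and "linear \<iota>" and "bij_betw \<iota> UNIV (lie_algebra A)"
  shows "iR_complete (\<lambda>x. inv \<iota> (euler_arnold A nabla (\<iota> x))) \<longleftrightarrow>
           degenerate_on (derived_algebra A) (metric_at_unit g) \<or>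
           (definite_on (derived_algebra A) (metric_at_unit g) \<and>
            indefinite_on (lie_algebra A) (metric_at_unit g))"
proof -
  interpret left_invariant_geometry A g nabla \<iota>
    by (rule left_invariant_geometry.intro[OF assms])
  interpret nondegenerate_form metric_form by (rule nondegenerate_metric_form)
  have "\<exists>\<alpha> \<beta>. bracket x y = \<alpha> *\<^sub>R x + \<beta> *\<^sub>R y" for x y
    using type_F[of x y] by (metis bracket_def inv_iota)
  then obtain l where l: "linear l" and bracket: "\<And>x y. bracket x y = l y *\<^sub>R x - l x *\<^sub>R y"
    using type_F_bracket_functional[OF bilinear_bracket bracket_anti] by metis
  obtain a where a: "\<And>z. metric_form a z = l z" using functional_represented[OF l] by blast
  obtain x y where xy: "bracket x y \<noteq> 0" using bracket_nonzero by blast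
  then obtain x0 where x0: "l x0 \<noteq> 0" by (metis bracket diff_0_right scaleR_zero_left)
  have "a \<noteq> 0" using a[of x0] x0 zero_left by auto
  have y0: "metric_form a (bracket x y) = 0"
    by (simp add: a bracket linear_diff[OF l] linear_scale[OF l])
  have "(\<lambda>x. inv \<iota> (euler_arnold A nabla (\<iota> x))) = type_F_field a"
  proof
    fix x
    have "euler_field x = type_F_field a x"
      by (rule eq_type_F_field[OF a]) (simp add: metric_euler_field bracket)
    then show "inv \<iota> (euler_arnold A nabla (\<iota> x)) = type_F_field a x" by (simp add: euler_field_def)
  qed
  moreover have "derived_algebra A = \<iota> ` {x. metric_form a x = 0}"
    using span_type_F_brackets[OF l x0] by (simp add: derived_algebra_eq bracket a)
  moreover have "iR_complete (type_F_field a) \<longleftrightarrow> (\<forall>x. metric_form a x = 0 \<longrightarrow> metric_form a a * metric_form x x \<le> 0)"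
    using imaginary_complete_if imaginary_complete_only_if by blast
  ultimately show ?thesis
    using perp_sign_condition_iff[OF \<open>a \<noteq> 0\<close> y0 xy]
    by (simp add: transport flip: range)
qed

end
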